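(* Let $D=(d_{ij})$ be an $n\times n$, $n\ge 3$, Euclidean distance matrix of embedding dimension $r=n-1$, and let $P$ be a configuration matrix of $D$, where $P^Te=0$. Let $S=P(P^TP)^{-1}$ and let $(s^i)^T$ be the $i$th row of $S$. Let $k\ne l$ be indices in $\{1,\ldots,n\}$. Then the yielding interval of the entry $d_{kl}$ is $$\left[\frac{2}{\lambda_r},\ \frac{2}{\lambda_1}\right],$$ where $\lambda_1=(s^k)^Ts^l+\|s^k\|\,\|s^l\|$ and $\lambda_r=(s^k)^Ts^l-\|s^k\|\,\|s^l\|$.
   Context: An $n\times n$ real matrix $D=(d_{ij})$ is a Euclidean distance matrix (EDM) if there exist points $p^1,\ldots,p^n$ in some Euclidean space with $d_{ij}=\|p^i-p^j\|^2$ for all $i,j$; the dimension of the affine span of such points is the embedding dimension $r$ of $D$. For $i\ne j$, $E^{ij}$ is the $n\times n$ symmetric matrix with 1's in the $ij$th and $ji$th entries and 0's elsewhere. The yielding interval of an off-diagonal entry $d_{ij}$ is the closed interval $[l_{ij},u_{ij}]$ such that $D+tE^{ij}$ is an EDM if and only if $l_{ij}\le t\le u_{ij}$. Let $e\in\mathbb{R}^n$ be the all-ones vector, $J=I_n-ee^T/n$, and $B=-\frac12 JDJ$, which is positive semidefinite of rank $r$. A configuration matrix of $D$ is an $n\times r$ matrix $P$ with $B=PP^T$ (so $P$ has rank $r$ and $P^Te=0$); its rows $(p^1)^T,\ldots,(p^n)^T$ give generating points of $D$. *)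

theory Defs
  imports "HOL-Analysis.Analysis"
begin

definition generating_points :: "('n::finite \<Rightarrow> 'a::euclidean_space) \<Rightarrow> real^'n^'n \<Rightarrow> bool" where
  "generating_points p D \<longleftrightarrow> (\<forall>i j. D $ i $ j = (norm (p i - p j))\<^sup>2)"

text \<open>
  A type cannot be quantified existentially, so ``some Euclidean space'' is rendered by the space
  \<open>real^'n\<close>, whose dimension is the number of points.  By \<open>is_EDM_generating_points\<close> and
  \<open>embedding_dim_generating_points\<close> below, points in any other Euclidean space give the same notions.
\<close>

definition is_EDM :: "real^'n^'n \<Rightarrow> bool" where
  "is_EDM D \<longleftrightarrow> (\<exists>p :: 'n \<Rightarrow> real^'n. generating_points p D)"

definition embedding_dim :: "real^'n^'n \<Rightarrow> nat" where
  "embedding_dim D =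
     (THE r. \<exists>p :: 'n \<Rightarrow> real^'n. generating_points p D \<and> aff_dim (range p) = int r)"

lemma is_EDM_generating_points:
  fixes p :: "'n::finite \<Rightarrow> 'a::euclidean_space"
  assumes "generating_points p D"
  shows "is_EDM D"
proof -
  define S where "S = span (range (\<lambda>i. p i - p undefined))"
  have "dim S \<le> card (range (\<lambda>i. p i - p undefined))"
    unfolding S_def dim_span by (rule dim_le_card') simp
  also have "\<dots> \<le> CARD('n)"
    by (rule card_image_le) simp
  finally have "dim S \<le> dim (UNIV :: (real^'n) set)"
    by simp
  then obtain f :: "'a \<Rightarrow> real^'n" where f: "linear f" "\<And>x. x \<in> S \<Longrightarrow> norm (f x) = norm x"
    using isometry_subset_subspace[of S "UNIV :: (real^'n) set"] S_def by auto
  have "norm (f (p i) - f (p j)) = norm (p i - p j)" for i j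
  proof -
    have "(p i - p undefined) - (p j - p undefined) \<in> S"
      unfolding S_def by (intro span_diff span_base) auto
    then have "norm (f (p i - p j)) = norm (p i - p j)"
      by (intro f(2)) simp
    then show ?thesis
      by (simp add: linear_diff[OF f(1)])
  qed
  then have "generating_points (\<lambda>i. f (p i)) D"
    using assms by (simp add: generating_points_def)
  then show ?thesis
    unfolding is_EDM_def by blast
qed

lemma generating_points_aff_dim_eq:
  fixes p :: "'n::finite \<Rightarrow> 'a::euclidean_space" and q :: "'n \<Rightarrow> 'b::euclidean_space"
  assumes p: "generating_points p D" and q: "generating_points q D"
  shows "aff_dim (range p) = aff_dim (range q)"
proof -
  define P where "P i = p i - p undefined" for i
  define Q where "Q i = q i - q undefined" for i
  define f where "f u = (\<Sum>i\<in>UNIV. (u $ i) *\<^sub>R P i)" for u :: "real^'n"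
  define g where "g u = (\<Sum>i\<in>UNIV. (u $ i) *\<^sub>R Q i)" for u :: "real^'n"
  have lf: "linear f" and lg: "linear g"
    unfolding f_def g_def
    by (auto intro!: linearI simp: scaleR_add_left sum.distrib scaleR_sum_right)
  have inner_diff: "x \<bullet> y = ((norm x)\<^sup>2 + (norm y)\<^sup>2 - (norm (x - y))\<^sup>2) / 2"
    for x y :: "'c::real_inner"
    by (simp add: power2_norm_eq_inner inner_diff_left inner_diff_right inner_commute)
  have gram: "P i \<bullet> P j = Q i \<bullet> Q j" for i j
  proof -
    have "(norm (p a - p b))\<^sup>2 = (norm (q a - q b))\<^sup>2" for a b
      using p q unfolding generating_points_def by metis
    then show ?thesis
      unfolding inner_diff[of "P i"] inner_diff[of "Q i"] by (simp add: P_def Q_def)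
  qed
  have "f u \<bullet> f u = g u \<bullet> g u" for u
    unfolding f_def g_def by (simp add: inner_sum_left inner_sum_right gram)
  then have ker: "f u = 0 \<longleftrightarrow> g u = 0" for u
    by (metis inner_eq_zero_iff)
  define N where "N = {u. f u = 0}"
  define W where "W = {w. \<forall>u\<in>N. orthogonal w u}"
  have N: "subspace N"
    unfolding N_def by (rule linear_subspace_kernel[OF lf])
  have W: "subspace W"
    unfolding W_def subspace_def by (auto simp: orthogonal_def inner_add_left)
  have NW: "u = 0" if "u \<in> N" "u \<in> W" for u
    using that unfolding W_def by (auto simp: orthogonal_def)
  have "dim W = dim (range P)" if h: "linear h" and hN: "\<And>u. h u = 0 \<longleftrightarrow> u \<in> N"
    and hP: "\<And>u. h u = (\<Sum>i\<in>UNIV. (u $ i) *\<^sub>R P i)"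
    for h :: "real^'n \<Rightarrow> 'c::euclidean_space" and P :: "'n \<Rightarrow> 'c"
  proof -
    have inj: "inj_on h (span W)"
    proof (rule inj_onI)
      fix x y assume "x \<in> span W" "y \<in> span W" "h x = h y"
      then have "x - y \<in> W" "h (x - y) = 0"
        using W h by (auto simp: span_eq_iff[THEN iffD2] linear_diff subspace_diff)
      then show "x = y"
        using NW[of "x - y"] hN by simp
    qed
    have "range h \<subseteq> h ` W"
    proof clarify
      fix u
      obtain y z where "y \<in> span N" "\<And>w. w \<in> span N \<Longrightarrow> orthogonal z w" "u = y + z"
        using orthogonal_subspace_decomp_exists[of N u] by blast
      then have "h u = h z" "z \<in> W"
        using N hN h by (auto simp: W_def linear_add span_base span_eq_iff[THEN iffD2])
      then show "h u \<in> h ` W" by blast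
    qed
    then have im: "h ` W = range h" by blast
    have "P i = h (axis i 1)" for i
      unfolding hP by (subst sum.remove[of _ i]) (auto simp: axis_def intro!: sum.neutral)
    then have "range P \<subseteq> range h" by blast
    moreover have "range h \<subseteq> span (range P)"
      unfolding hP by (auto intro: span_sum span_scale span_base)
    ultimately have "dim (range h) = dim (range P)"
      by (metis dim_span dim_subset order_antisym)
    then show ?thesis
      using dim_image_eq[OF h inj] im by simp
  qed note * = this
  have "dim W = dim (range P)"
    by (rule *[OF lf]) (auto simp: N_def f_def)
  moreover have "dim W = dim (range Q)"
    by (rule *[OF lg]) (auto simp: N_def g_def ker)
  ultimately have "dim (range P) = dim (range Q)" by simp
  moreover have "aff_dim (range p) = int (dim (range P))"
    by (subst aff_dim_eq_dim[of "p undefined"]) (auto simp: P_def hull_inc image_image)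
  moreover have "aff_dim (range q) = int (dim (range Q))"
    by (subst aff_dim_eq_dim[of "q undefined"]) (auto simp: Q_def hull_inc image_image)
  ultimately show ?thesis by simp
qed

lemma embedding_dim_generating_points:
  fixes p :: "'n::finite \<Rightarrow> 'a::euclidean_space"
  assumes "generating_points p D"
  shows "int (embedding_dim D) = aff_dim (range p)"
proof -
  obtain q :: "'n \<Rightarrow> real^'n" where q: "generating_points q D"
    using is_EDM_generating_points[OF assms] unfolding is_EDM_def by blast
  obtain r where r: "aff_dim (range q) = int r"
    using aff_dim_eq_dim[of "q undefined" "range q"] by (auto simp: hull_inc)
  have "embedding_dim D = r"
    unfolding embedding_dim_def
    by (rule the_equality) (use q r generating_points_aff_dim_eq in \<open>auto, force\<close>)
  then show ?thesis
    using r generating_points_aff_dim_eq[OF assms q] by simp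
qed

definition E_mat :: "'n::finite \<Rightarrow> 'n \<Rightarrow> real^'n^'n" where
  "E_mat i j = (\<chi> a b. if (a = i \<and> b = j) \<or> (a = j \<and> b = i) then 1 else 0)"

definition yielding_interval :: "real^'n^'n \<Rightarrow> 'n \<Rightarrow> 'n \<Rightarrow> real \<Rightarrow> real \<Rightarrow> bool" where
  "yielding_interval D i j l u \<longleftrightarrow>
     (\<forall>t. is_EDM (D + t *\<^sub>R E_mat i j) \<longleftrightarrow> l \<le> t \<and> t \<le> u)"

definition J_mat :: "real^'n^'n" where
  "J_mat = mat 1 - (1 / real CARD('n)) *\<^sub>R ((columnvector 1 :: real^1^'n) ** rowvector 1)"

definition configuration_matrix :: "real^'n^'n \<Rightarrow> real^'r^'n \<Rightarrow> bool" where
  "configuration_matrix D P \<longleftrightarrow>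
     CARD('r) = embedding_dim D \<and>
     (- (1 / 2)) *\<^sub>R (J_mat ** D ** J_mat) = P ** transpose P"

end

theory Submission
  imports Defs
begin

text \<open>
  Because the embedding dimension is \<open>n - 1\<close>, the rows \<open>p\<^sub>1, \<dots>, p\<^sub>n\<close> of \<open>P\<close> are the vertices of a
  simplex that spans its space.  The identity \<open>S (P\<^sup>T P) = P\<close> then says that the row \<open>s\<^sub>k\<close> of \<open>S\<close>
  is the gradient of the \<open>k\<close>-th barycentric coordinate of this simplex: \<open>s\<^sub>k \<bullet> p\<^sub>i\<close> equals
  \<open>[i = k] - 1/n\<close> (\<open>row_pseudoinverse\<close>, \<open>simplex_coordinate_gradient\<close>).  Consequently
  \<open>(s\<^sub>k \<bullet> (p\<^sub>i - p\<^sub>j)) (s\<^sub>l \<bullet> (p\<^sub>i - p\<^sub>j))\<close> is \<open>-1\<close> if \<open>{i, j} = {k, l}\<close> and \<open>0\<close> otherwise, so that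
  the entries of \<open>D + t E\<close> are the values of the quadratic form
  \<open>Q(y) = |y|\<^sup>2 - t (s\<^sub>k \<bullet> y) (s\<^sub>l \<bullet> y)\<close> at the edges \<open>y = p\<^sub>i - p\<^sub>j\<close>.

  If \<open>D + t E\<close> is a distance matrix, then \<open>Q \<ge> 0\<close>: every vector \<open>y\<close> is a combination of the
  vertices with weights of sum zero, and a distance matrix is negative semidefinite on such weights
  (\<open>is_EDM_add_E_mat_imp\<close>).  Conversely, a linear map \<open>f\<close> with \<open>|f y|\<^sup>2 = Q(y)\<close> sends the simplex to
  points that generate \<open>D + t E\<close>.

  Everything therefore depends on the product of two linear functionals, which is diagonal in the
  orthogonal directions \<open>w = a/|a| + b/|b|\<close> and \<open>z = a/|a| - b/|b|\<close>, where \<open>a = s\<^sub>k\<close> and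
  \<open>b = s\<^sub>l\<close>.  Its values at the unit vectors along them are \<open>\<lambda>\<^sub>1/2\<close> and \<open>\<lambda>\<^sub>r/2\<close>.  Testing \<open>Q \<ge> 0\<close> at
  \<open>w\<close> and \<open>z\<close> gives \<open>t \<lambda>\<^sub>1 \<le> 2\<close> and \<open>t \<lambda>\<^sub>r \<le> 2\<close>; under these two bounds \<open>f\<close> is obtained by
  rescaling along \<open>w\<close> and \<open>z\<close> (\<open>is_EDM_add_E_mat_iff\<close>).
  Finally \<open>\<lambda>\<^sub>r < 0 < \<lambda>\<^sub>1\<close> is the strict Cauchy-Schwarz inequality, which holds because with
  a third vertex available the two gradients cannot be parallel (\<open>gradients_not_parallel\<close>).
\<close>

section \<open>The quadratic form of a distance matrix\<close>

text \<open>
  The terms \<open>|q\<^sub>i|\<^sup>2\<close> and \<open>|q\<^sub>j|\<^sup>2\<close> of the expanded square each leave one free sum of weights, which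
  is zero; only the mixed term survives.
\<close>

lemma sum_squared_distances:
  fixes q :: "'n::finite \<Rightarrow> 'a::real_inner" and x :: "'n \<Rightarrow> real"
  assumes "(\<Sum>i\<in>UNIV. x i) = 0"
  shows "(\<Sum>i\<in>UNIV. \<Sum>j\<in>UNIV. x i * x j * (norm (q i - q j))\<^sup>2)
       = - 2 * (norm (\<Sum>i\<in>UNIV. x i *\<^sub>R q i))\<^sup>2"
proof -
  have "x i * x j * (norm (q i - q j))\<^sup>2
      = (x i * (q i \<bullet> q i)) * x j + x i * (x j * (q j \<bullet> q j)) - 2 * (x i *\<^sub>R q i \<bullet> x j *\<^sub>R q j)" for i j
    by (simp add: power2_norm_eq_inner inner_diff_left inner_diff_right inner_commute algebra_simps)
  moreover have "(\<Sum>i\<in>UNIV. \<Sum>j\<in>UNIV. x i *\<^sub>R q i \<bullet> x j *\<^sub>R q j)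
      = (norm (\<Sum>i\<in>UNIV. x i *\<^sub>R q i))\<^sup>2"
    unfolding power2_norm_eq_inner by (simp only: inner_sum_left) (simp only: inner_sum_right)
  ultimately show ?thesis
    by (simp only: sum.distrib sum_subtractf assms mult_zero_left mult_zero_right
        flip: sum_distrib_left sum_distrib_right) simp
qed

lemma sum_E_mat:
  fixes x :: "'n::finite \<Rightarrow> real"
  assumes "k \<noteq> l"
  shows "(\<Sum>i\<in>UNIV. \<Sum>j\<in>UNIV. x i * x j * E_mat k l $ i $ j) = 2 * (x k * x l)"
proof -
  have "x i * x j * E_mat k l $ i $ j
      = (if i = k then if j = l then x k * x l else 0 else 0)
      + (if i = l then if j = k then x k * x l else 0 else 0)" for i j
    using assms by (auto simp: E_mat_def)
  then show ?thesis
    by (simp add: sum.distrib if_distrib[of "\<lambda>c. sum c _"] sum.If_cases)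
qed

text \<open>
  Weights of sum zero are those for which the choice of origin is irrelevant, so the combinations that
  they form are exactly the combinations of the differences \<open>p i - p undefined\<close>.
\<close>

lemma linear_combination_zero_weights:
  fixes p :: "'n::finite \<Rightarrow> 'a::euclidean_space"
  assumes "affine hull range p = UNIV"
  obtains x where "(\<Sum>i\<in>UNIV. x i) = 0" "(\<Sum>i\<in>UNIV. x i *\<^sub>R p i) = y"
proof -
  have "y \<in> span (range (\<lambda>i. p i - p undefined))"
  proof -
    have "(\<lambda>x. - p undefined + x) ` range p = range (\<lambda>i. p i - p undefined)"
      by (simp add: image_image)
    then have "(\<lambda>x. p undefined + x) ` span (range (\<lambda>i. p i - p undefined)) = UNIV"
      using affine_hull_span_gen[of "p undefined" "range p"] assms by simp
    then have "p undefined + y \<in> (\<lambda>x. p undefined + x) ` span (range (\<lambda>i. p i - p undefined))"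
      by simp
    then show ?thesis
      by (simp only: inj_image_mem_iff[OF inj_on_add])
  qed
  moreover have "\<exists>x. (\<Sum>i\<in>UNIV. x i) = 0 \<and> (\<Sum>i\<in>UNIV. x i *\<^sub>R p i) = y"
    if "y \<in> span (range (\<lambda>i. p i - p undefined))" for y
    using that
  proof (induction rule: span_induct_alt)
    case base
    show ?case by (intro exI[of _ "\<lambda>_. 0"]) simp
  next
    case (step c b y)
    then obtain x i where x: "(\<Sum>i\<in>UNIV. x i) = 0" "(\<Sum>i\<in>UNIV. x i *\<^sub>R p i) = y"
      and i: "b = p i - p undefined" by auto
    define x' where "x' j = (if j = i then c else 0) - (if j = undefined then c else 0) + x j" for j
    have "(\<Sum>i\<in>UNIV. x' i) = 0"
      by (simp add: x'_def sum.distrib sum_subtractf x)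
    moreover have "(\<Sum>i\<in>UNIV. x' i *\<^sub>R p i) = c *\<^sub>R b + y"
      by (simp add: x'_def scaleR_add_left scaleR_diff_left sum.distrib sum_subtractf x i
          if_distrib[of "\<lambda>c. c *\<^sub>R _"] scaleR_diff_right cong: if_cong)
    ultimately show ?case by blast
  qed
  ultimately show ?thesis using that by blast
qed

section \<open>Changing one squared distance\<close>

lemma E_mat_eq_gradient_product:
  fixes p :: "'n::finite \<Rightarrow> 'a::real_inner"
  assumes "k \<noteq> l"
    and "\<And>i j. a \<bullet> (p i - p j) = of_bool (i = k) - of_bool (j = k)"
    and "\<And>i j. b \<bullet> (p i - p j) = of_bool (i = l) - of_bool (j = l)"
  shows "E_mat k l $ i $ j = - ((a \<bullet> (p i - p j)) * (b \<bullet> (p i - p j)))"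
  using assms(1) by (auto simp: assms(2,3) E_mat_def)

text \<open>
  Since \<open>w\<close> and \<open>z\<close> are orthogonal, the two corrections do not interact.  The coefficients
  \<open>\<alpha>\<close> and \<open>\<beta>\<close> are at our disposal to produce a prescribed form that is diagonal along \<open>w\<close> and \<open>z\<close>.
\<close>

lemma norm_rank_two_update:
  fixes w z y :: "'a::real_inner"
  assumes "w \<bullet> z = 0"
  shows "(norm (y - (\<alpha> * (w \<bullet> y)) *\<^sub>R w - (\<beta> * (z \<bullet> y)) *\<^sub>R z))\<^sup>2
       = (norm y)\<^sup>2 - (2 * \<alpha> - \<alpha>\<^sup>2 * (w \<bullet> w)) * (w \<bullet> y)\<^sup>2
                   - (2 * \<beta> - \<beta>\<^sup>2 * (z \<bullet> z)) * (z \<bullet> y)\<^sup>2"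
proof -
  have "z \<bullet> w = 0" "y \<bullet> w = w \<bullet> y" "y \<bullet> z = z \<bullet> y"
    using assms by (simp_all add: inner_commute)
  with assms show ?thesis
    by (simp add: power2_norm_eq_inner inner_diff_left inner_diff_right)
       (simp add: power2_eq_square algebra_simps)
qed

text \<open>
  A quadratic equation for \<open>\<alpha>\<close> whose discriminant is nonnegative exactly when \<open>c m \<le> 1\<close>.  With
  \<open>m = |w|\<^sup>2\<close> this is the condition that \<open>|y|\<^sup>2 - c (w \<bullet> y)\<^sup>2\<close> be nonnegative.
\<close>

lemma rank_one_update_coefficient:
  fixes c m :: real
  assumes "c * m \<le> 1" "m > 0"
  obtains \<alpha> where "2 * \<alpha> - \<alpha>\<^sup>2 * m = c"
proof
  define r where "r = sqrt (1 - c * m)"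
  have r: "r\<^sup>2 = 1 - c * m" using assms by (simp add: r_def)
  have "2 * ((1 - r) / m) - ((1 - r) / m)\<^sup>2 * m = (1 - r\<^sup>2) / m"
    using assms(2) by (simp add: field_simps power2_eq_square)
  then show "2 * ((1 - r) / m) - ((1 - r) / m)\<^sup>2 * m = c"
    using assms(2) by (simp add: r)
qed

text \<open>
  The symmetric form behind \<open>(a \<bullet> y) (b \<bullet> y)\<close> is diagonalized by the bisectors of \<open>a, b\<close> and of
  \<open>a, -b\<close>: for unit vectors \<open>u, v\<close> this is the identity
  \<open>4 (u \<bullet> y) (v \<bullet> y) = ((u + v) \<bullet> y)\<^sup>2 - ((u - v) \<bullet> y)\<^sup>2\<close>.
\<close>

lemma product_of_functionals_diagonal:
  fixes a b :: "'a::real_inner"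
  assumes "a \<noteq> 0" "b \<noteq> 0"
  defines "w \<equiv> sgn a + sgn b" and "z \<equiv> sgn a - sgn b"
  shows "w \<bullet> z = 0"
    and "(a \<bullet> y) * (b \<bullet> y) = (norm a * norm b / 4) * ((w \<bullet> y)\<^sup>2 - (z \<bullet> y)\<^sup>2)"
    and "norm a * norm b * (w \<bullet> w) = 2 * (a \<bullet> b + norm a * norm b)"
    and "norm a * norm b * (z \<bullet> z) = - 2 * (a \<bullet> b - norm a * norm b)"
    and "(a \<bullet> w) * (b \<bullet> w) = (norm a * norm b / 4) * (w \<bullet> w)\<^sup>2"
    and "(a \<bullet> z) * (b \<bullet> z) = - (norm a * norm b / 4) * (z \<bullet> z)\<^sup>2"
proof -
  have unit: "sgn a \<bullet> sgn a = 1" "sgn b \<bullet> sgn b = 1"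
    using assms by (simp_all add: norm_sgn flip: power2_norm_eq_inner)
  then show wz: "w \<bullet> z = 0"
    by (simp add: w_def z_def inner_add_left inner_diff_right inner_commute[of "sgn b" "sgn a"])
  have ab: "a = norm a *\<^sub>R sgn a" "b = norm b *\<^sub>R sgn b"
    using assms by (simp_all add: sgn_div_norm)
  have ip: "(a \<bullet> y) * (b \<bullet> y) = (norm a * norm b / 4) * ((w \<bullet> y)\<^sup>2 - (z \<bullet> y)\<^sup>2)" for y
    by (subst ab(1), subst ab(2))
      (simp add: w_def z_def inner_add_left inner_diff_left power2_eq_square algebra_simps)
  show "(a \<bullet> y) * (b \<bullet> y) = (norm a * norm b / 4) * ((w \<bullet> y)\<^sup>2 - (z \<bullet> y)\<^sup>2)"
    by (rule ip)
  show "(a \<bullet> w) * (b \<bullet> w) = (norm a * norm b / 4) * (w \<bullet> w)\<^sup>2"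
    using wz by (simp add: ip inner_commute)
  show "(a \<bullet> z) * (b \<bullet> z) = - (norm a * norm b / 4) * (z \<bullet> z)\<^sup>2"
    using wz by (simp add: ip inner_commute)
  have "norm a * norm b * (sgn a \<bullet> sgn b) = a \<bullet> b"
    by (metis ab inner_scaleR_left inner_scaleR_right mult.assoc)
  then show "norm a * norm b * (w \<bullet> w) = 2 * (a \<bullet> b + norm a * norm b)"
    and "norm a * norm b * (z \<bullet> z) = - 2 * (a \<bullet> b - norm a * norm b)"
    using unit
    by (simp_all add: w_def z_def inner_add_left inner_add_right inner_diff_left inner_diff_right
        inner_commute[of "sgn b" "sgn a"] algebra_simps)
qed

text \<open>
  Here \<open>a\<close> and \<open>b\<close> are gradients of barycentric coordinates, so that writing \<open>y\<close> with weights \<open>x\<close> of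
  sum zero yields \<open>a \<bullet> y = x k\<close> and \<open>b \<bullet> y = x l\<close>.  The quadratic form of \<open>D + t E\<close> at \<open>x\<close> is
  nonpositive for any generating points, and in terms of \<open>y\<close> it reads
  \<open>-2 |y|\<^sup>2 + 2 t (a \<bullet> y) (b \<bullet> y)\<close>.
\<close>

lemma is_EDM_add_E_mat_imp:
  fixes p :: "'n::finite \<Rightarrow> 'a::euclidean_space"
  assumes D: "generating_points p D" and kl: "k \<noteq> l"
    and full: "affine hull range p = UNIV"
    and a: "\<And>i j. a \<bullet> (p i - p j) = of_bool (i = k) - of_bool (j = k)"
    and b: "\<And>i j. b \<bullet> (p i - p j) = of_bool (i = l) - of_bool (j = l)"
    and E: "is_EDM (D + t *\<^sub>R E_mat k l)"
  shows "t * ((a \<bullet> y) * (b \<bullet> y)) \<le> y \<bullet> y"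
proof -
  obtain q :: "'n \<Rightarrow> real^'n" where q: "generating_points q (D + t *\<^sub>R E_mat k l)"
    using E is_EDM_def by blast
  obtain x where x: "(\<Sum>i\<in>UNIV. x i) = 0" "(\<Sum>i\<in>UNIV. x i *\<^sub>R p i) = y"
    using linear_combination_zero_weights[OF full] by blast
  \<comment> \<open>As the weights have sum zero, the vertex \<open>p m\<close> can serve as the origin.\<close>
  have weight: "c \<bullet> y = x m"
    if "\<And>i j. c \<bullet> (p i - p j) = of_bool (i = m) - of_bool (j = m)" for c m
  proof -
    have "y = (\<Sum>i\<in>UNIV. x i *\<^sub>R (p i - p m))"
      by (simp add: x scaleR_diff_right sum_subtractf flip: scaleR_sum_left)
    then have "c \<bullet> y = (\<Sum>i\<in>UNIV. (if i = m then x i else 0) - x i)"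
      by (auto simp: inner_sum_right that intro!: sum.cong)
    then show ?thesis
      by (simp add: sum_subtractf x)
  qed
  have "(\<Sum>i\<in>UNIV. \<Sum>j\<in>UNIV. x i * x j * (norm (q i - q j))\<^sup>2)
      = (\<Sum>i\<in>UNIV. \<Sum>j\<in>UNIV. x i * x j * (norm (p i - p j))\<^sup>2)
        + t * (\<Sum>i\<in>UNIV. \<Sum>j\<in>UNIV. x i * x j * E_mat k l $ i $ j)"
  proof -
    have "(norm (q i - q j))\<^sup>2 = (norm (p i - p j))\<^sup>2 + t * E_mat k l $ i $ j" for i j
      using q D by (simp add: generating_points_def)
    then show ?thesis
      by (simp add: distrib_left sum.distrib sum_distrib_left mult_ac)
  qed
  then have "- 2 * (norm (\<Sum>i\<in>UNIV. x i *\<^sub>R q i))\<^sup>2 = - 2 * (y \<bullet> y) + 2 * (t * (x k * x l))"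
    unfolding sum_squared_distances[OF x(1)] sum_E_mat[OF kl] x(2)
    by (simp add: power2_norm_eq_inner)
  then have "t * (x k * x l) = y \<bullet> y - (norm (\<Sum>i\<in>UNIV. x i *\<^sub>R q i))\<^sup>2"
    by linarith
  then show ?thesis
    using weight[OF a] weight[OF b] by simp
qed

text \<open>
  The quadratic form \<open>|y|\<^sup>2 - t (a \<bullet> y) (b \<bullet> y)\<close> splits along \<open>w\<close> and \<open>z\<close>, and the two bounds on \<open>t\<close>
  say that it is nonnegative in these two directions.  That is necessary by the previous lemma and
  enough to write the form as \<open>|f y|\<^sup>2\<close> with an explicit linear \<open>f\<close>.
\<close>

lemma is_EDM_add_E_mat_iff:
  fixes p :: "'n::finite \<Rightarrow> 'a::euclidean_space"
  assumes D: "generating_points p D" and kl: "k \<noteq> l"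
    and full: "affine hull range p = UNIV"
    and a: "\<And>i j. a \<bullet> (p i - p j) = of_bool (i = k) - of_bool (j = k)"
    and b: "\<And>i j. b \<bullet> (p i - p j) = of_bool (i = l) - of_bool (j = l)"
    and pos: "a \<bullet> b + norm a * norm b > 0" and neg: "a \<bullet> b - norm a * norm b < 0"
  shows "is_EDM (D + t *\<^sub>R E_mat k l) \<longleftrightarrow>
    t * (a \<bullet> b + norm a * norm b) \<le> 2 \<and> t * (a \<bullet> b - norm a * norm b) \<le> 2"
proof -
  have nz: "a \<noteq> 0" "b \<noteq> 0"
    using pos by auto
  define w where "w = sgn a + sgn b"
  define z where "z = sgn a - sgn b"
  \<comment> \<open>With this \<open>c\<close>, the form to be realized is \<open>|y|\<^sup>2 - c (w \<bullet> y)\<^sup>2 + c (z \<bullet> y)\<^sup>2\<close>.\<close>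
  define c where "c = t * (norm a * norm b / 4)"
  note diag = product_of_functionals_diagonal[OF nz, folded w_def z_def]
  have N: "norm a * norm b > 0"
    using nz by simp
  have "norm a * norm b * (w \<bullet> w) > 0" "norm a * norm b * (z \<bullet> z) > 0"
    unfolding diag(3,4) using pos neg by simp_all
  then have wz: "w \<bullet> w > 0" "z \<bullet> z > 0"
    using N by (simp_all only: zero_less_mult_pos)
  have "4 * (c * (w \<bullet> w)) = t * (norm a * norm b * (w \<bullet> w))"
       "4 * (- c * (z \<bullet> z)) = - t * (norm a * norm b * (z \<bullet> z))"
    by (simp_all add: c_def)
  then have bounds: "t * (a \<bullet> b + norm a * norm b) \<le> 2 \<longleftrightarrow> c * (w \<bullet> w) \<le> 1"
    "t * (a \<bullet> b - norm a * norm b) \<le> 2 \<longleftrightarrow> - c * (z \<bullet> z) \<le> 1"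
    unfolding diag(3,4) by (auto simp: algebra_simps)
  show ?thesis
  proof
    assume E: "is_EDM (D + t *\<^sub>R E_mat k l)"
    have "(c * (w \<bullet> w)) * (w \<bullet> w) \<le> 1 * (w \<bullet> w)"
      using is_EDM_add_E_mat_imp[OF D kl full a b E, of w]
      by (simp add: diag(5) c_def power2_eq_square mult_ac)
    moreover have "(- c * (z \<bullet> z)) * (z \<bullet> z) \<le> 1 * (z \<bullet> z)"
      using is_EDM_add_E_mat_imp[OF D kl full a b E, of z]
      by (simp add: diag(6) c_def power2_eq_square mult_ac)
    ultimately show "t * (a \<bullet> b + norm a * norm b) \<le> 2 \<and> t * (a \<bullet> b - norm a * norm b) \<le> 2"
      unfolding bounds using wz by (metis mult_le_cancel_right_pos)
  next
    assume "t * (a \<bullet> b + norm a * norm b) \<le> 2 \<and> t * (a \<bullet> b - norm a * norm b) \<le> 2"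
    then obtain \<alpha> \<beta> where \<alpha>: "2 * \<alpha> - \<alpha>\<^sup>2 * (w \<bullet> w) = c" and \<beta>: "2 * \<beta> - \<beta>\<^sup>2 * (z \<bullet> z) = - c"
      unfolding bounds using wz by (meson rank_one_update_coefficient)
    define f where "f y = y - (\<alpha> * (w \<bullet> y)) *\<^sub>R w - (\<beta> * (z \<bullet> y)) *\<^sub>R z" for y
    have "(norm (f y))\<^sup>2 = (norm y)\<^sup>2 - t * ((a \<bullet> y) * (b \<bullet> y))" for y
      unfolding f_def norm_rank_two_update[OF diag(1)] \<alpha> \<beta> diag(2)
      by (simp add: c_def algebra_simps)
    moreover have "f (p i) - f (p j) = f (p i - p j)" for i j
      by (simp add: f_def inner_diff_right algebra_simps)
    ultimately have "generating_points (\<lambda>i. f (p i)) (D + t *\<^sub>R E_mat k l)"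
      using D unfolding generating_points_def
      by (simp add: E_mat_eq_gradient_product[OF kl a b])
    then show "is_EDM (D + t *\<^sub>R E_mat k l)"
      by (rule is_EDM_generating_points)
  qed
qed

text \<open>
  Along the edge from a third vertex \<open>m\<close> to \<open>l\<close> the \<open>l\<close>-th barycentric coordinate changes while the
  \<open>k\<close>-th does not, which rules out equality in the Cauchy-Schwarz inequality.  For a segment, with only
  two vertices, the two gradients are opposite.
\<close>

lemma gradients_not_parallel:
  fixes p :: "'n::finite \<Rightarrow> 'a::real_inner"
  assumes "CARD('n) \<ge> 3" and "k \<noteq> l"
    and a: "\<And>i j. a \<bullet> (p i - p j) = of_bool (i = k) - of_bool (j = k)"
    and b: "\<And>i j. b \<bullet> (p i - p j) = of_bool (i = l) - of_bool (j = l)"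
  shows "\<bar>a \<bullet> b\<bar> < norm a * norm b"
proof -
  have "card {k, l} < CARD('n)"
    using assms(1,2) by simp
  then have "{k, l} \<noteq> UNIV"
    by (metis order_less_irrefl)
  then obtain m where m: "m \<noteq> k" "m \<noteq> l"
    by blast
  have "\<bar>a \<bullet> b\<bar> \<noteq> norm a * norm b"
  proof
    assume "\<bar>a \<bullet> b\<bar> = norm a * norm b"
    then have "norm a *\<^sub>R b = norm b *\<^sub>R a \<or> norm a *\<^sub>R b = - norm b *\<^sub>R a"
      by (simp add: norm_cauchy_schwarz_abs_eq)
    then have "norm a * (b \<bullet> y) = norm b * (a \<bullet> y) \<or> norm a * (b \<bullet> y) = - norm b * (a \<bullet> y)" for y
      by (metis inner_scaleR_left)
    from this[of "p l - p m"] have "norm a = 0"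
      using m \<open>k \<noteq> l\<close> by (simp add: a b)
    with a[of k m] m show False
      by simp
  qed
  then show ?thesis
    using Cauchy_Schwarz_ineq2[of a b] by simp
qed

section \<open>The rows of a configuration matrix\<close>

lemma J_mat_mult_component:
  fixes M :: "real^'m^'n"
  shows "(J_mat ** M) $ i $ j = M $ i $ j - (\<Sum>a\<in>UNIV. M $ a $ j) / real CARD('n)"
proof -
  have "(J_mat :: real^'n^'n) $ i $ a = of_bool (i = a) - 1 / real CARD('n)" for a
    by (simp add: J_mat_def mat_def matrix_matrix_mult_def columnvector_def rowvector_def)
  then show ?thesis
    by (simp add: matrix_matrix_mult_def left_diff_distrib sum_subtractf of_bool_def
        if_distrib[of "\<lambda>c. c * _"] flip: sum_divide_distrib cong: if_cong)
qed

lemma mult_J_mat_component: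
  fixes M :: "real^'n^'m"
  shows "(M ** J_mat) $ i $ j = M $ i $ j - (\<Sum>b\<in>UNIV. M $ i $ b) / real CARD('n)"
proof -
  have "(J_mat :: real^'n^'n) $ b $ j = of_bool (b = j) - 1 / real CARD('n)" for b
    by (simp add: J_mat_def mat_def matrix_matrix_mult_def columnvector_def rowvector_def)
  then show ?thesis
    by (simp add: matrix_matrix_mult_def right_diff_distrib sum_subtractf of_bool_def
        if_distrib[of "\<lambda>c. _ * c"] flip: sum_divide_distrib cong: if_cong)
qed

text \<open>
  Double centring changes \<open>D\<close> only by a function of the row plus a function of the column, and these
  cancel in \<open>B\<^sub>i\<^sub>i - 2 B\<^sub>i\<^sub>j + B\<^sub>j\<^sub>j\<close>, the squared distance of rows \<open>i\<close> and \<open>j\<close> of \<open>P\<close> when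
  \<open>B = P P\<^sup>T\<close>.
\<close>

lemma configuration_matrix_generating_points:
  fixes D :: "real^'n^'n" and P :: "real^'r^'n"
  assumes "is_EDM D" and "configuration_matrix D P"
  shows "generating_points (\<lambda>i. row i P) D"
proof -
  obtain q :: "'n \<Rightarrow> real^'n" where q: "generating_points q D"
    using assms(1) is_EDM_def by blast
  have sym: "D $ i $ j = D $ j $ i" and diag: "D $ i $ i = 0" for i j
    using q by (simp_all add: generating_points_def norm_minus_commute)
  define \<rho> where "\<rho> i = (\<Sum>b\<in>UNIV. D $ i $ b) / real CARD('n)" for i
  define \<tau> where "\<tau> = (\<Sum>b\<in>UNIV. \<rho> b) / real CARD('n)"
  have "(\<Sum>a\<in>UNIV. D $ a $ j) / real CARD('n) = \<rho> j" for j
    unfolding \<rho>_def by (subst sym) simp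
  then have JDJ: "(J_mat ** D ** J_mat) $ i $ j = D $ i $ j - \<rho> i - \<rho> j + \<tau>" for i j
    by (simp add: mult_J_mat_component J_mat_mult_component sum_subtractf diff_divide_distrib \<rho>_def \<tau>_def)
  have gram: "row i P \<bullet> row j P = - (D $ i $ j - \<rho> i - \<rho> j + \<tau>) / 2" for i j
  proof -
    have "row i P \<bullet> row j P = (P ** transpose P) $ i $ j"
      by (simp add: inner_vec_def row_def matrix_matrix_mult_def transpose_def)
    also have "P ** transpose P = (- (1 / 2)) *\<^sub>R (J_mat ** D ** J_mat)"
      using assms(2) by (simp add: configuration_matrix_def)
    finally show ?thesis
      by (simp add: JDJ field_simps)
  qed
  show ?thesis
    unfolding generating_points_def power2_norm_eq_inner inner_diff_left inner_diff_right gram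
    by (simp add: diag sym field_simps)
qed

text \<open>
  Since the points have mean zero, the hypothesis on \<open>s\<close> says that the difference of the two sides
  of the conclusion is, as a function of \<open>i\<close>, an affine dependence between the vertices of a simplex, hence zero.
\<close>

lemma simplex_coordinate_gradient:
  fixes p :: "'n::finite \<Rightarrow> 'a::euclidean_space"
  assumes inj: "inj p" and indep: "\<not> affine_dependent (range p)"
    and centred: "(\<Sum>i\<in>UNIV. p i) = 0"
    and s: "(\<Sum>i\<in>UNIV. (s \<bullet> p i) *\<^sub>R p i) = p k"
  shows "s \<bullet> p i = of_bool (i = k) - 1 / real CARD('n)"
proof -
  define c where "c i = s \<bullet> p i - of_bool (i = k) + 1 / real CARD('n)" for i
  have "(\<Sum>i\<in>UNIV. c i) = 0"
    by (simp add: c_def sum.distrib sum_subtractf centred flip: inner_sum_right)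
  moreover have "(\<Sum>i\<in>UNIV. c i *\<^sub>R p i) = 0"
    by (simp add: c_def scaleR_add_left scaleR_diff_left sum.distrib sum_subtractf s centred
        of_bool_def if_distrib[of "\<lambda>c. c *\<^sub>R _"] flip: scaleR_sum_right cong: if_cong)
  ultimately have "(\<Sum>v\<in>range p. c (inv p v)) = 0" "(\<Sum>v\<in>range p. c (inv p v) *\<^sub>R v) = 0"
    using inj by (simp_all add: sum.reindex)
  then have "c (inv p (p i)) = 0"
    using indep unfolding affine_dependent_explicit_finite[OF finite_imageI[OF finite]]
    by (metis rangeI)
  then show ?thesis
    using inj by (simp add: c_def)
qed

text \<open>
  The \<open>n\<close> points are distinct because a set of affine dimension \<open>n - 1\<close> has at least \<open>n\<close> elements.
\<close>

lemma simplex_if_aff_dim: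
  fixes p :: "'n::finite \<Rightarrow> 'a::euclidean_space"
  assumes "aff_dim (range p) = int CARD('n) - 1"
  shows "inj p" and "\<not> affine_dependent (range p)"
proof -
  have "card (range p) \<le> CARD('n)"
    by (simp add: card_image_le)
  moreover have "aff_dim (range p) \<le> int (card (range p)) - 1"
    by (rule aff_dim_le_card) simp
  ultimately have "card (range p) = CARD('n)"
    using assms by linarith
  then show "inj p" "\<not> affine_dependent (range p)"
    using assms by (simp_all add: eq_card_imp_inj_on affine_independent_iff_card)
qed

text \<open>
  This is row \<open>k\<close> of the identity \<open>S P\<^sup>T P = P\<close>.  The hypothesis makes the Gram matrix \<open>P\<^sup>T P\<close>
  invertible: a vector in its kernel is orthogonal to every row of \<open>P\<close>, and a linear hyperplane cannot
  contain points whose affine hull is the whole space.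
\<close>

lemma row_pseudoinverse:
  fixes P :: "real^'r^'n"
  assumes full: "affine hull range (\<lambda>i. row i P) = UNIV"
  defines "S \<equiv> P ** matrix_inv (transpose P ** P)"
  shows "(\<Sum>i\<in>UNIV. (row k S \<bullet> row i P) *\<^sub>R row i P) = row k P"
proof -
  have "invertible (transpose P ** P)"
    unfolding invertible_left_inverse matrix_left_invertible_ker
  proof (intro allI impI)
    fix x assume "(transpose P ** P) *v x = 0"
    then have "x \<bullet> (transpose P *v (P *v x)) = 0"
      by (simp add: matrix_vector_mul_assoc)
    then have "P *v x = 0"
      by (metis dot_lmul_matrix inner_eq_zero_iff transpose_transpose vector_transpose_matrix)
    then have "row i P \<bullet> x = 0" for i
      by (metis matrix_vector_mul_component row_def vec_lambda_eta zero_index)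
    then have "range (\<lambda>i. row i P) \<subseteq> {y. x \<bullet> y = 0}"
      by (auto simp: inner_commute)
    then have "affine hull range (\<lambda>i. row i P) \<subseteq> {y. x \<bullet> y = 0}"
      by (rule hull_minimal) (rule affine_hyperplane)
    then have "x \<in> {y. x \<bullet> y = 0}"
      using full by blast
    then show "x = 0"
      by simp
  qed
  then have "matrix_inv (transpose P ** P) ** (transpose P ** P) = mat 1"
    unfolding matrix_inv_def invertible_def by (rule someI2_ex) blast
  then have "S ** (transpose P ** P) = P"
    by (simp add: S_def flip: matrix_mul_assoc)
  then have SP: "(S ** transpose P) ** P = P"
    by (simp add: matrix_mul_assoc)
  have "(S ** transpose P) $ k $ i = row k S \<bullet> row i P" for i
    by (simp add: inner_vec_def row_def matrix_matrix_mult_def transpose_def)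
  moreover have "((S ** transpose P) ** P) $ k $ j = (\<Sum>i\<in>UNIV. (S ** transpose P) $ k $ i * P $ i $ j)" for j
    by (simp add: matrix_matrix_mult_def)
  ultimately have "(\<Sum>i\<in>UNIV. (row k S \<bullet> row i P) * P $ i $ j) = P $ k $ j" for j
    unfolding SP by simp
  then show ?thesis
    by (simp add: vec_eq_iff row_def)
qed

theorem theorem4p1:
  fixes D :: "real^'n^'n" and P S :: "real^'r^'n" and k l :: 'n
    and lambda_1 lambda_r :: real
  assumes "CARD('n) \<ge> 3"
    and "is_EDM D"
    and "embedding_dim D = CARD('n) - 1"
    and "configuration_matrix D P"
    and "transpose P *v 1 = 0"
    and "k \<noteq> l"
  defines "S \<equiv> P ** matrix_inv (transpose P ** P)"
    and "lambda_1 \<equiv> row k S \<bullet> row l S + norm (row k S) * norm (row l S)"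
    and "lambda_r \<equiv> row k S \<bullet> row l S - norm (row k S) * norm (row l S)"
  shows "lambda_1 \<noteq> 0 \<and> lambda_r \<noteq> 0 \<and>
    yielding_interval D k l (2 / lambda_r) (2 / lambda_1)"
proof -
  define p where "p i = row i P" for i
  have D: "generating_points p D"
    using configuration_matrix_generating_points[OF assms(2,4)] by (simp add: p_def[abs_def])
  have dim: "aff_dim (range p) = int CARD('n) - 1"
    using embedding_dim_generating_points[OF D] assms(1,3) by simp
  note simplex = simplex_if_aff_dim[OF dim]
  have "aff_dim (range p) = int DIM(real^'r)"
    using embedding_dim_generating_points[OF D] assms(4) by (simp add: configuration_matrix_def)
  then have full: "affine hull range p = UNIV"
    using aff_dim_eq_full by blast
  have centred: "(\<Sum>i\<in>UNIV. p i) = 0"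
    using assms(5) by (simp add: vec_eq_iff p_def row_def matrix_vector_mult_def transpose_def)
  have grad: "row m S \<bullet> (p i - p j) = of_bool (i = m) - of_bool (j = m)" for m i j
  proof -
    have "(\<Sum>i\<in>UNIV. (row m S \<bullet> p i) *\<^sub>R p i) = p m"
      using row_pseudoinverse[of P] full by (simp add: p_def[abs_def] S_def)
    from simplex_coordinate_gradient[OF simplex centred this]
    show ?thesis by (simp add: inner_diff_right)
  qed
  have "\<bar>row k S \<bullet> row l S\<bar> < norm (row k S) * norm (row l S)"
    by (rule gradients_not_parallel[OF assms(1,6) grad grad])
  then have pos: "lambda_1 > 0" and neg: "lambda_r < 0"
    by (auto simp: lambda_1_def lambda_r_def)
  have "is_EDM (D + t *\<^sub>R E_mat k l) \<longleftrightarrow> t * lambda_1 \<le> 2 \<and> t * lambda_r \<le> 2" for t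
    unfolding lambda_1_def lambda_r_def
    by (rule is_EDM_add_E_mat_iff[OF D assms(6) full grad grad
          pos[unfolded lambda_1_def] neg[unfolded lambda_r_def]])
  then have "yielding_interval D k l (2 / lambda_r) (2 / lambda_1)"
    unfolding yielding_interval_def
    using pos neg by (auto simp: pos_le_divide_eq neg_divide_le_eq)
  then show ?thesis
    using pos neg by simp
qed

end
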